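(* Let $g\in\mathcal G$, $\alpha\in(0,1)$ and $\lambda>0$. Let $\operatorname{CS}_\alpha(X)$ be a $(1-\alpha)$-credible set for the improper prior $\pi(\theta)\propto\mathbf 1(|\theta|>\lambda)$ in the model $X=\theta+\varepsilon$, $\varepsilon\sim g$. Then $\operatorname{PS}_\alpha(X)=\operatorname{CS}_\alpha^{-1}(X)$ is a $(1-\alpha)$-post-selection set, i.e. for every $\theta_0\in\mathbb R$, $$P_{\theta_0}\big(\theta_0\in\operatorname{PS}_\alpha(X)\,\big|\,|X|\ge\lambda\big)\ge1-\alpha.$$
   Context: $\mathcal G$ is the class of positive continuous probability densities $g$ on $\mathbb R$ that are symmetric around zero and strictly decreasing on $[0,\infty)$. $P_{\theta_0}$ is the distribution of $X=\theta_0+\varepsilon$, $\varepsilon$ having density $g$. The prior is the "$\theta$-min prior" with slab weight $w=1$; its posterior is $\Pi(A|X=x)=\int_{A\cap\{|\theta|>\lambda\}}g(\theta-x)\,d\theta\big/\int_{|\theta|>\lambda}g(\theta-x)\,d\theta$. A $(1-\alpha)$-credible set is a set-valued map $x\mapsto\operatorname{CS}_\alpha(x)\subseteq\mathbb R$ with measurable values such that $\Pi(\operatorname{CS}_\alpha(x)|X=x)\ge1-\alpha$ for every $x\in\mathbb R$. For a set-valued function $A$, the inverse is $A^{-1}(x)=\{y:x\in A(y)\}$. *)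

theory Defs
  imports "HOL-Probability.Probability"
begin

definition symm_density_class :: "(real \<Rightarrow> real) set" where
  "symm_density_class = {g.
     (\<forall>x. 0 < g x) \<and> continuous_on UNIV g \<and>
     integrable lborel g \<and> (LBINT x. g x) = 1 \<and>
     (\<forall>x. g (- x) = g x) \<and> strict_antimono_on {0..} g}"

text \<open>Law of \<open>X = \<theta>\<^sub>0 + \<epsilon>\<close>, where \<open>\<epsilon>\<close> has Lebesgue density \<open>g\<close>.\<close>

definition location_law :: "(real \<Rightarrow> real) \<Rightarrow> real \<Rightarrow> real measure" where
  "location_law g \<theta>\<^sub>0 = distr (density lborel (\<lambda>e. ennreal (g e))) borel (\<lambda>e. \<theta>\<^sub>0 + e)"

text \<open>Posterior probability of \<open>A\<close> given \<open>X = x\<close> under the improper prior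
  \<open>\<pi>(\<theta>) \<propto> 1(\<bar>\<theta>\<bar> > lam)\<close>. The likelihood is written \<open>g (\<theta> - x)\<close>, which is
  \<open>g (x - \<theta>)\<close> by symmetry of \<open>g\<close>.\<close>

definition posterior :: "(real \<Rightarrow> real) \<Rightarrow> real \<Rightarrow> real \<Rightarrow> real set \<Rightarrow> real" where
  "posterior g lam x A =
     (LBINT \<theta>:A \<inter> {\<theta>. \<bar>\<theta>\<bar> > lam}. g (\<theta> - x)) / (LBINT \<theta>:{\<theta>. \<bar>\<theta>\<bar> > lam}. g (\<theta> - x))"

definition credible_set :: "(real \<Rightarrow> real) \<Rightarrow> real \<Rightarrow> real \<Rightarrow> (real \<Rightarrow> real set) \<Rightarrow> bool" where
  "credible_set g lam \<alpha> CS \<longleftrightarrow>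
     (\<forall>x. CS x \<in> sets borel \<and> posterior g lam x (CS x) \<ge> 1 - \<alpha>)"

definition set_valued_inverse :: "('a \<Rightarrow> 'b set) \<Rightarrow> 'b \<Rightarrow> 'a set" where
  "set_valued_inverse A x = {y. x \<in> A y}"

text \<open>Measurability of the coverage event is required explicitly, since \<open>cond_prob\<close>
  is only meaningful for measurable events.\<close>

definition post_selection_set :: "(real \<Rightarrow> real) \<Rightarrow> real \<Rightarrow> real \<Rightarrow> (real \<Rightarrow> real set) \<Rightarrow> bool" where
  "post_selection_set g lam \<alpha> PS \<longleftrightarrow>
     (\<forall>\<theta>\<^sub>0. {x. \<theta>\<^sub>0 \<in> PS x} \<in> sets borel \<and>
        cond_prob (location_law g \<theta>\<^sub>0) (\<lambda>x. \<theta>\<^sub>0 \<in> PS x) (\<lambda>x. \<bar>x\<bar> \<ge> lam) \<ge> 1 - \<alpha>)"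

end

theory Submission
  imports Defs
begin

text \<open>The likelihood \<open>g (x - \<theta>)\<close> can be read as a density in the parameter or as a density in
  the observation. By definition of the inverse, the event that \<open>\<theta>\<^sub>0\<close> is covered is the
  event \<open>X \<in> CS \<theta>\<^sub>0\<close>, so the coverage probability integrates
  \<open>x \<mapsto> g (x - \<theta>\<^sub>0)\<close> over \<open>CS \<theta>\<^sub>0\<close>. The posterior mass of \<open>CS \<theta>\<^sub>0\<close> given the
  \<^emph>\<open>observation\<close> \<open>\<theta>\<^sub>0\<close> integrates the same function over the same set, and truncating the
  flat prior to \<open>\<bar>\<theta>\<bar> > lam\<close> corresponds to conditioning on the selection event
  \<open>\<bar>X\<bar> \<ge> lam\<close>, up to the two boundary points. Hence the conditional coverage at \<open>\<theta>\<^sub>0\<close>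
  is exactly the posterior credibility of \<open>CS \<theta>\<^sub>0\<close> given \<open>X = \<theta>\<^sub>0\<close>.\<close>

lemma measure_location_law:
  fixes g :: "real \<Rightarrow> real"
  assumes [measurable]: "g \<in> borel_measurable borel" and nonneg: "\<And>x. 0 \<le> g x"
    and [measurable]: "A \<in> sets borel"
  shows "measure (location_law g t) A = (LBINT x:A. g (x - t))"
proof -
  let ?D = "density lborel (\<lambda>e. ennreal (g e))"
  have "measure (location_law g t) A = measure ?D ((\<lambda>e. t + e) -` A)"
    unfolding location_law_def by (subst measure_distr) auto
  also have "\<dots> = integral\<^sup>L ?D (indicator ((\<lambda>e. t + e) -` A))"
    by simp
  also have "\<dots> = (LBINT e. g e *\<^sub>R indicator ((\<lambda>e. t + e) -` A) e)"
    by (subst integral_density) (auto simp: nonneg)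
  also have "\<dots> = (LBINT e. indicator A (t + e) *\<^sub>R g e)"
    by (simp add: indicator_def mult.commute)
  also have "\<dots> = (LBINT x:A. g (x - t))"
    unfolding set_lebesgue_integral_def
    by (subst (2) lborel_integral_real_affine[where c = 1 and t = t]) auto
  finally show ?thesis .
qed

text \<open>Selection uses \<open>\<ge>\<close> and truncation of the prior uses \<open>>\<close>; the difference is
  confined to the points \<open>c\<close> and \<open>- c\<close>, which carry no Lebesgue mass.\<close>

lemma set_integral_abs_ge_eq_abs_gt:
  fixes f :: "real \<Rightarrow> real"
  assumes [measurable]: "f \<in> borel_measurable borel" "A \<in> sets borel"
  shows "(LBINT x:A \<inter> {x. \<bar>x\<bar> \<ge> c}. f x) = (LBINT x:A \<inter> {x. \<bar>x\<bar> > c}. f x)"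
  unfolding set_lebesgue_integral_def
proof (rule integral_cong_AE)
  have "AE x in lborel. x \<noteq> c \<and> x \<noteq> - c"
    using AE_lborel_singleton[of c] AE_lborel_singleton[of "- c"] by eventually_elim simp
  then show "AE x in lborel. indicator (A \<inter> {x. \<bar>x\<bar> \<ge> c}) x *\<^sub>R f x
      = indicator (A \<inter> {x. \<bar>x\<bar> > c}) x *\<^sub>R f x"
    by eventually_elim (auto simp: indicator_def)
qed measurable

text \<open>The duality between frequentist and Bayesian probabilities behind the theorem: the
  parameter of the location law on the left is the observation on the right.\<close>

lemma cond_prob_location_law_eq_posterior:
  fixes g :: "real \<Rightarrow> real"
  assumes [measurable]: "g \<in> borel_measurable borel" and nonneg: "\<And>x. 0 \<le> g x"
    and A [measurable]: "A \<in> sets borel"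
  shows "cond_prob (location_law g t) (\<lambda>x. x \<in> A) (\<lambda>x. \<bar>x\<bar> \<ge> lam) = posterior g lam t A"
proof -
  have tail: "measure (location_law g t) (B \<inter> {x. \<bar>x\<bar> \<ge> lam})
      = (LBINT x:B \<inter> {x. \<bar>x\<bar> > lam}. g (x - t))" if [measurable]: "B \<in> sets borel" for B
  proof -
    have "measure (location_law g t) (B \<inter> {x. \<bar>x\<bar> \<ge> lam})
        = (LBINT x:B \<inter> {x. \<bar>x\<bar> \<ge> lam}. g (x - t))"
      by (rule measure_location_law) (auto simp: nonneg)
    also have "\<dots> = (LBINT x:B \<inter> {x. \<bar>x\<bar> > lam}. g (x - t))"
      by (rule set_integral_abs_ge_eq_abs_gt) auto
    finally show ?thesis .
  qed
  have "space (location_law g t) = UNIV"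
    by (simp add: location_law_def)
  then show ?thesis
    using tail[OF A] tail[of UNIV] by (simp add: cond_prob_def posterior_def Int_def)
qed

theorem lemma4p1:
  fixes g :: "real \<Rightarrow> real" and \<alpha> lam :: real and CS :: "real \<Rightarrow> real set"
  assumes "g \<in> symm_density_class"
    and "0 < \<alpha>" and "\<alpha> < 1"
    and "0 < lam"
    and "credible_set g lam \<alpha> CS"
  shows "post_selection_set g lam \<alpha> (set_valued_inverse CS)"
proof -
  have g: "g \<in> borel_measurable borel" "\<And>x. 0 \<le> g x"
    using assms(1) by (auto simp: symm_density_class_def less_imp_le
        intro: borel_measurable_continuous_onI)
  have CS: "CS x \<in> sets borel" "posterior g lam x (CS x) \<ge> 1 - \<alpha>" for x
    using assms(5) by (auto simp: credible_set_def)
  have "\<theta>\<^sub>0 \<in> set_valued_inverse CS x \<longleftrightarrow> x \<in> CS \<theta>\<^sub>0" for \<theta>\<^sub>0 x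
    by (simp add: set_valued_inverse_def)
  then show ?thesis
    using CS by (simp add: post_selection_set_def cond_prob_location_law_eq_posterior[OF g])
qed

end
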